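(* Let $\omega\in\Omega$. There is a bijection $\Lambda$ from $\mathcal P^{\omega}_\rho$ to $\mathcal P^{\omega}_{\mathcal S}$ which preserves the size and the colour sequence when the last part $\omega$ of elements of $\mathcal P^{\omega}_\rho$ is omitted.
   Context: $m\ge1$, $\mathcal O=\{1<2<\dots<m\}$, $\overline x:=m+1-x$. $\chi$ = truth value in $\{0,1\}$. Primary-coloured integers $k_{c_u}$ ($k\in\mathbb Z$, $u\in\mathcal O$) ordered by $k_{c_u}\ge l_{c_v}$ iff $k-l\ge\chi(u<v)$, strictly $>$ iff $k-l\ge\chi(u\le v)$; $k_c+1=(k+1)_c$. $succ(k_{c_u})=k_{c_{u+1}}$ for $u<m$, $succ(k_{c_m})=(k+1)_{c_1}$. Secondary colours $c_{x,y}=c_xc_y$ ($x\le y$); $\mathbb Z_{\mathcal S}$ = secondary-coloured integers; $\eta(2k_{c_{x,y}})=k_{c_y}$, $\zeta(2k_{c_{x,y}})=k_{c_x}$, $\eta((2k+1)_{c_{x,y}})=(k+1)_{c_x}$, $\zeta((2k+1)_{c_{x,y}})=k_{c_y}$. Each pair $(a,b)$ of primary-coloured integers with $b\le a\le b+1$ is $(\eta(e),\zeta(e))$ for exactly one $e\in\mathbb Z_{\mathcal S}$, and for every $e$, $\eta(e)=succ^u(\zeta(e))$ for a unique $u\in\{0,\dots,m\}$. Order on $\mathbb Z_{\mathcal S}$: $e\ge e'$ iff $\eta(e)>\eta(e')$ or ($\eta(e)=\eta(e')$ and $\zeta(e)\le\zeta(e')$). For $e$ with $\eta(e)=succ^u(\zeta(e))$,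 $u\le m-1$: $d(e)$ has $\eta=\eta(e)$, $\zeta=succ^{-1}(\zeta(e))$; $f(e)$ has $\eta=succ(\eta(e))$, $\zeta=\zeta(e)$. A path is $(e_0,\dots,e_m)$ in $\mathbb Z_{\mathcal S}$ with $e_{j+1}\in\{d(e_j),f(e_j)\}$; a path in $X$ has all $e_j\in X$. $\rho(c_{x',y'},c_{x,y})=\chi(x\ge x')+\chi(y\ge y')-\chi(y\ge y'>x\ge x')$, $k_c\gg_\rho l_d$ iff $k-l\ge\rho(c,d)$. $\omega_0=(-1)_{c_{m,m}}$, $\omega_i=0_{c_{i,\overline{i+1}}}$ ($1\le i\le\lfloor m/2\rfloor$), $\Omega=\{\omega_u:0\le u\le\lfloor m/2\rfloor\}\sqcup\{0_{c_{u,\overline u}}:1\le u\le\lceil m/2\rceil\}$, $\mathbb Z^+_{\mathcal S}=\{0_{c_{x,y}}:m\ge y\ge x>\overline y\ge1\}\sqcup\{k_c\in\mathbb Z_{\mathcal S}:k>0\}$. $\mathcal P^{\omega}_\rho$: sequences $(\pi_0,\dots,\pi_{s-1},\omega)$ in $\mathbb Z_{\mathcal S}$ with consecutive parts related by $\gg_\rho$. $\mathcal P^\omega_{\mathcal S}$: finite multisets of elements of $\mathbb Z^+_{\mathcal S}$ (viewed as partitions non-increasing for $\ge$) whose frequencies $f_u$, extended by $f_u=\chi(u=\omega)$ for $u\in\Omega$, satisfy $f_{e_0}+\dots+f_{e_m}\le1$ for every path $(e_0,\dots,e_m)$ in $\Omega\sqcup\mathbb Z^+_{\mathcal S}$. Size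 = sum of sizes $k$ of parts $k_c$; colour sequence = product of colours. *)

theory Defs
  imports "HOL-Library.Multiset"
begin

text \<open>
  The integer \<open>k\<close> of colour \<open>c\<^sub>u\<close> is \<open>(k, u)\<close>, and the integer \<open>k\<close> of colour
  \<open>c\<^sub>x\<^sub>,\<^sub>y\<close> is \<open>(k, x, y)\<close>. The carriers \<open>ZP m\<close> and \<open>ZS m\<close> impose the bounds on the indices.
\<close>

type_synonym prim = "int \<times> nat"
type_synonym sec = "int \<times> nat \<times> nat"

definition ZP :: "nat \<Rightarrow> prim set" where
  "ZP m = {(k, u). 1 \<le> u \<and> u \<le> m}"

definition ZS :: "nat \<Rightarrow> sec set" where
  "ZS m = {(k, x, y). 1 \<le> x \<and> x \<le> y \<and> y \<le> m}"

fun prim_ge :: "prim \<Rightarrow> prim \<Rightarrow> bool" where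
  "prim_ge (k, u) (l, v) \<longleftrightarrow> k - l \<ge> of_bool (u < v)"

fun prim_gt :: "prim \<Rightarrow> prim \<Rightarrow> bool" where
  "prim_gt (k, u) (l, v) \<longleftrightarrow> k - l \<ge> of_bool (u \<le> v)"

fun psucc :: "nat \<Rightarrow> prim \<Rightarrow> prim" where
  "psucc m (k, u) = (if u < m then (k, u + 1) else (k + 1, 1))"

definition ppred :: "nat \<Rightarrow> prim \<Rightarrow> prim" where
  "ppred m = inv_into (ZP m) (psucc m)"

fun eta :: "sec \<Rightarrow> prim" where
  "eta (k, x, y) = (if even k then (k div 2, y) else (k div 2 + 1, x))"

fun zeta :: "sec \<Rightarrow> prim" where
  "zeta (k, x, y) = (if even k then (k div 2, x) else (k div 2, y))"

definition sec_ge :: "sec \<Rightarrow> sec \<Rightarrow> bool" where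
  "sec_ge e e' \<longleftrightarrow> prim_gt (eta e) (eta e') \<or> eta e = eta e' \<and> prim_ge (zeta e') (zeta e)"

definition sec_of :: "nat \<Rightarrow> prim \<Rightarrow> prim \<Rightarrow> sec" where
  "sec_of m a b = (THE e. e \<in> ZS m \<and> eta e = a \<and> zeta e = b)"

definition dstep :: "nat \<Rightarrow> sec \<Rightarrow> sec" where
  "dstep m e = sec_of m (eta e) (ppred m (zeta e))"

definition fstep :: "nat \<Rightarrow> sec \<Rightarrow> sec" where
  "fstep m e = sec_of m (psucc m (eta e)) (zeta e)"

text \<open>The elements on which \<open>dstep\<close> and \<open>fstep\<close> are meaningful.\<close>

definition extendable :: "nat \<Rightarrow> sec \<Rightarrow> bool" where
  "extendable m e \<longleftrightarrow> e \<in> ZS m \<and> (\<exists>u<m. eta e = (psucc m ^^ u) (zeta e))"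

definition path_in :: "nat \<Rightarrow> sec set \<Rightarrow> sec list \<Rightarrow> bool" where
  "path_in m X es \<longleftrightarrow> length es = m + 1 \<and> set es \<subseteq> ZS m \<inter> X \<and>
     (\<forall>j<m. extendable m (es ! j) \<and> es ! (j + 1) \<in> {dstep m (es ! j), fstep m (es ! j)})"

fun rho :: "nat \<times> nat \<Rightarrow> nat \<times> nat \<Rightarrow> int" where
  "rho (x', y') (x, y) =
     of_bool (x \<ge> x') + of_bool (y \<ge> y') - of_bool (y \<ge> y' \<and> y' > x \<and> x \<ge> x')"

fun gg_rho :: "sec \<Rightarrow> sec \<Rightarrow> bool" where
  "gg_rho (k, c) (l, d) \<longleftrightarrow> k - l \<ge> rho c d"

definition bar :: "nat \<Rightarrow> nat \<Rightarrow> nat" where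
  "bar m x = m + 1 - x"

definition omega :: "nat \<Rightarrow> nat \<Rightarrow> sec" where
  "omega m i = (if i = 0 then (-1, m, m) else (0, i, bar m (i + 1)))"

text \<open>Here \<open>(m + 1) div 2\<close> is the ceiling of \<open>m / 2\<close>.\<close>

definition Omega :: "nat \<Rightarrow> sec set" where
  "Omega m = {omega m u | u. u \<le> m div 2} \<union>
             {(0, u, bar m u) | u. 1 \<le> u \<and> u \<le> (m + 1) div 2}"

definition ZS_pos :: "nat \<Rightarrow> sec set" where
  "ZS_pos m = {(0, x, y) | x y. m \<ge> y \<and> y \<ge> x \<and> x > bar m y \<and> bar m y \<ge> 1} \<union>
              {(k, c) | k c. (k, c) \<in> ZS m \<and> k > 0}"

definition P_rho :: "nat \<Rightarrow> sec \<Rightarrow> sec list set" where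
  "P_rho m w = {\<pi> @ [w] | \<pi>. set \<pi> \<subseteq> ZS m \<and> successively gg_rho (\<pi> @ [w])}"

definition freq :: "nat \<Rightarrow> sec \<Rightarrow> sec multiset \<Rightarrow> sec \<Rightarrow> nat" where
  "freq m w M e = (if e \<in> Omega m then of_bool (e = w) else count M e)"

definition path_condition :: "nat \<Rightarrow> sec \<Rightarrow> sec multiset \<Rightarrow> bool" where
  "path_condition m w M \<longleftrightarrow>
     (\<forall>es. path_in m (Omega m \<union> ZS_pos m) es \<longrightarrow> (\<Sum>e\<leftarrow>es. freq m w M e) \<le> 1)"

text \<open>
  A finite multiset of secondary-coloured integers is represented by its unique listing that is
  non-increasing for \<open>sec_ge\<close>; see \<open>bij_betw_mset_P_S\<close> below.
\<close>

definition P_S :: "nat \<Rightarrow> sec \<Rightarrow> sec list set" where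
  "P_S m w = {\<pi>. set \<pi> \<subseteq> ZS_pos m \<and> sorted_wrt sec_ge \<pi> \<and> path_condition m w (mset \<pi>)}"

definition part_size :: "sec list \<Rightarrow> int" where
  "part_size \<pi> = (\<Sum>p\<leftarrow>\<pi>. fst p)"

text \<open>
  The product of the colours is non-commutative, so it is the list of the colours of the parts.
\<close>

definition colour_seq :: "sec list \<Rightarrow> (nat \<times> nat) list" where
  "colour_seq \<pi> = map snd \<pi>"


lemma bij_betw_psucc:
  assumes "m \<ge> 1"
  shows "bij_betw (psucc m) (ZP m) (ZP m)"
proof (rule bij_betwI')
  fix a b assume "a \<in> ZP m" "b \<in> ZP m"
  then show "psucc m a = psucc m b \<longleftrightarrow> a = b"
    by (cases a; cases b) (auto simp: ZP_def split: if_splits)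
next
  fix a assume "a \<in> ZP m"
  then show "psucc m a \<in> ZP m"
    using assms by (cases a) (auto simp: ZP_def)
next
  fix b assume b: "b \<in> ZP m"
  obtain k u where ku: "b = (k, u)" by (cases b)
  show "\<exists>a\<in>ZP m. b = psucc m a"
  proof (cases "u = 1")
    case True
    then show ?thesis using assms ku by (intro bexI[of _ "(k - 1, m)"]) (auto simp: ZP_def)
  next
    case False
    then show ?thesis using b ku by (intro bexI[of _ "(k, u - 1)"]) (auto simp: ZP_def)
  qed
qed

lemma eta_zeta_inj:
  assumes "e \<in> ZS m" "e' \<in> ZS m" "eta e = eta e'" "zeta e = zeta e'"
  shows "e = e'"
proof -
  obtain k x y l x' y' where e: "e = (k, x, y)" "e' = (l, x', y')"
    by (metis prod.exhaust)
  have "even k \<longleftrightarrow> even l"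
    using assms(3,4) by (auto simp: e split: if_splits)
  moreover have "k div 2 = l div 2"
    using assms(4) by (auto simp: e split: if_splits)
  ultimately have "k = l"
    by presburger
  then show ?thesis
    using assms(3,4) by (auto simp: e split: if_splits)
qed

lemma sec_of_unique:
  assumes "a \<in> ZP m" "b \<in> ZP m" "prim_ge a b" "prim_ge (fst b + 1, snd b) a"
  shows "\<exists>!e. e \<in> ZS m \<and> eta e = a \<and> zeta e = b"
proof -
  obtain k u l v where ab: "a = (k, u)" "b = (l, v)" by (cases a; cases b)
  have "\<exists>e. e \<in> ZS m \<and> eta e = a \<and> zeta e = b"
  proof (cases "k = l")
    case True
    then show ?thesis
      using assms by (intro exI[of _ "(2 * k, v, u)"]) (auto simp: ab ZP_def ZS_def of_bool_def split: if_splits)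
  next
    case False
    then have "k = l + 1" "u \<le> v"
      using assms by (auto simp: ab of_bool_def split: if_splits)
    then show ?thesis
      using assms by (intro exI[of _ "(2 * l + 1, u, v)"]) (auto simp: ab ZP_def ZS_def)
  qed
  then obtain e where e: "e \<in> ZS m" "eta e = a" "zeta e = b" by blast
  show ?thesis
  proof (rule ex1I[of _ e])
    fix e' assume "e' \<in> ZS m \<and> eta e' = a \<and> zeta e' = b"
    then show "e' = e" using eta_zeta_inj[of e' m e] e by simp
  qed (use e in simp)
qed

lemma prim_ge_iff: "prim_ge a b \<longleftrightarrow> fst a > fst b \<or> fst a = fst b \<and> snd a \<ge> snd b"
  by (cases a; cases b) auto

lemma prim_gt_iff: "prim_gt a b \<longleftrightarrow> fst a > fst b \<or> fst a = fst b \<and> snd a > snd b"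
  by (cases a; cases b) auto

lemma sec_ge_total: "sec_ge e e' \<or> sec_ge e' e"
  unfolding sec_ge_def prim_ge_iff prim_gt_iff prod_eq_iff by linarith

lemma sec_ge_trans:
  assumes "sec_ge e e'" "sec_ge e' e''"
  shows "sec_ge e e''"
proof -
  have gt: "prim_gt (eta e) (eta e'')"
    if "prim_gt (eta e) (eta e')" "prim_gt (eta e') (eta e'')"
    using that unfolding prim_gt_iff by linarith
  have ge: "prim_ge (zeta e'') (zeta e)"
    if "prim_ge (zeta e') (zeta e)" "prim_ge (zeta e'') (zeta e')"
    using that unfolding prim_ge_iff by linarith
  show ?thesis
    using assms gt ge unfolding sec_ge_def by fastforce
qed

lemma sec_ge_antisym:
  assumes "e \<in> ZS m" "e' \<in> ZS m" "sec_ge e e'" "sec_ge e' e"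
  shows "e = e'"
proof -
  have gt: "\<not> prim_gt a b" if "prim_gt b a \<or> a = b" for a b
    using that unfolding prim_gt_iff by auto
  have ge: "a = b" if "prim_ge a b" "prim_ge b a" for a b
    using that unfolding prim_ge_iff prod_eq_iff by auto
  have eta: "eta e = eta e'"
    using assms(3,4) gt[of "eta e" "eta e'"] unfolding sec_ge_def by auto
  then have "zeta e = zeta e'"
    using assms(3,4) gt[of "eta e" "eta e'"] ge[of "zeta e" "zeta e'"] unfolding sec_ge_def by auto
  with eta show ?thesis
    using eta_zeta_inj[OF assms(1,2)] by blast
qed

lemma ZS_pos_subset: "ZS_pos m \<subseteq> ZS m"
  by (auto simp: ZS_pos_def ZS_def bar_def)

lemma sorted_sec_ge_unique:
  assumes "mset xs = mset ys" "sorted_wrt sec_ge xs" "sorted_wrt sec_ge ys" "set xs \<subseteq> ZS m"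
  shows "xs = ys"
  using assms
proof (induction xs arbitrary: ys)
  case Nil
  then show ?case by simp
next
  case (Cons x xs)
  then obtain y ys' where ys: "ys = y # ys'" by (cases ys) auto
  have eq: "set (x # xs) = set (y # ys')"
    using Cons.prems(1) ys by (metis set_mset_mset)
  have "x = y"
  proof (rule ccontr)
    assume "x \<noteq> y"
    then have "sec_ge x y" "sec_ge y x"
      using Cons.prems(2,3) eq ys by auto
    moreover have "x \<in> ZS m" "y \<in> ZS m"
      using Cons.prems(4) eq by auto
    ultimately show False
      using sec_ge_antisym \<open>x \<noteq> y\<close> by blast
  qed
  then show ?case using Cons ys by auto
qed

lemma sorted_sec_ge_exists: "\<exists>xs. mset xs = M \<and> sorted_wrt sec_ge xs"
proof (induction M)
  case empty
  then show ?case by (intro exI[of _ "[]"]) auto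
next
  case (add e M)
  then obtain xs where xs: "mset xs = M" "sorted_wrt sec_ge xs" by blast
  define l where "l = filter (\<lambda>x. sec_ge x e) xs"
  define r where "r = filter (\<lambda>x. \<not> sec_ge x e) xs"
  have r: "sec_ge e x" if "x \<in> set r" for x
    using that sec_ge_total[of e x] by (auto simp: r_def)
  moreover have l: "sec_ge x e" if "x \<in> set l" for x
    using that by (auto simp: l_def)
  moreover have "sec_ge x y" if "x \<in> set l" "y \<in> set r" for x y
    using sec_ge_trans[OF l[OF that(1)] r[OF that(2)]] .
  moreover have "sorted_wrt sec_ge l" "sorted_wrt sec_ge r"
    using xs(2) by (simp_all add: l_def r_def sorted_wrt_filter)
  ultimately have "sorted_wrt sec_ge (l @ e # r)"
    by (simp add: sorted_wrt_append)
  moreover have "mset (l @ e # r) = add_mset e M"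
    by (simp add: l_def r_def xs(1)[symmetric])
  ultimately show ?case by blast
qed

lemma bij_betw_mset_P_S:
  "bij_betw mset (P_S m w) {M. set_mset M \<subseteq> ZS_pos m \<and> path_condition m w M}"
proof (rule bij_betw_imageI)
  show "inj_on mset (P_S m w)"
  proof (rule inj_onI)
    fix xs ys assume "xs \<in> P_S m w" "ys \<in> P_S m w" "mset xs = mset ys"
    then show "xs = ys"
      using ZS_pos_subset[of m] by (intro sorted_sec_ge_unique[of xs ys m]) (auto simp: P_S_def)
  qed
  show "mset ` P_S m w = {M. set_mset M \<subseteq> ZS_pos m \<and> path_condition m w M}"
  proof
    show "mset ` P_S m w \<subseteq> {M. set_mset M \<subseteq> ZS_pos m \<and> path_condition m w M}"
      by (auto simp: P_S_def)
    show "{M. set_mset M \<subseteq> ZS_pos m \<and> path_condition m w M} \<subseteq> mset ` P_S m w"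
    proof
      fix M assume M: "M \<in> {M. set_mset M \<subseteq> ZS_pos m \<and> path_condition m w M}"
      obtain xs where xs: "mset xs = M" "sorted_wrt sec_ge xs"
        using sorted_sec_ge_exists by blast
      then show "M \<in> mset ` P_S m w"
        using M by (intro image_eqI[of _ _ xs]) (auto simp: P_S_def)
    qed
  qed
qed

end

theory Submission
  imports Defs
begin

text \<open>
  Place \<open>k\<^sub>c\<^sub>u\<close> at the point \<open>k * m + u\<close> of the integer line. A secondary-coloured integer \<open>e\<close>
  becomes the interval from \<open>\<zeta>(e)\<close> to \<open>\<eta>(e)\<close>, and all intervals of length at most \<open>m\<close> arise exactly
  once. A path is a chain of nested intervals of lengths \<open>0, \<dots>, m\<close>, and \<open>\<Omega> \<squnion> \<int>\<^sup>+\<close> consists of the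
  intervals whose end points have sum at least \<open>m\<close>, those in \<open>\<Omega>\<close> having sum \<open>m\<close> or \<open>m + 1\<close>. Any two
  nested intervals of this set lie on a common path inside it, so the path condition says that no two
  of the parts, \<open>\<omega>\<close> included, are nested. On the other hand \<open>e \<ggreater>\<^sub>\<rho> e'\<close> means precisely that both end
  points of \<open>e\<close> exceed those of \<open>e'\<close>. Hence both sets of partitions describe the same
  sequences, and \<open>\<Lambda>\<close> just omits the last part.
\<close>

section \<open>Coordinates of coloured integers on the line\<close>

definition pos :: "nat \<Rightarrow> prim \<Rightarrow> int" where
  "pos m a = fst a * int m + int (snd a)"

definition lo :: "nat \<Rightarrow> sec \<Rightarrow> int" where
  "lo m e = pos m (zeta e)"

definition hi :: "nat \<Rightarrow> sec \<Rightarrow> int" where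
  "hi m e = pos m (eta e)"

text \<open>Colour indices lie between 1 and \<open>m\<close>, so two of them differ by less than
  \<open>m\<close> and any change of size outweighs them.\<close>

lemma pos_less_iff:
  assumes "a \<in> ZP m" "b \<in> ZP m"
  shows "pos m a < pos m b \<longleftrightarrow> prim_gt b a"
proof -
  obtain k u l v where ab: "a = (k, u)" "b = (l, v)" by (cases a; cases b)
  have uv: "1 \<le> u" "u \<le> m" "1 \<le> v" "v \<le> m"
    using assms by (auto simp: ab ZP_def)
  consider "k + 1 \<le> l" | "k = l" | "l + 1 \<le> k" by linarith
  then show ?thesis
  proof cases
    case 1
    then have "(k + 1) * int m \<le> l * int m"
      by (intro mult_right_mono) auto
    then show ?thesis
      using 1 uv by (auto simp: ab pos_def prim_gt_iff algebra_simps)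
  next
    case 2
    then show ?thesis by (auto simp: ab pos_def prim_gt_iff)
  next
    case 3
    then have "(l + 1) * int m \<le> k * int m"
      by (intro mult_right_mono) auto
    then show ?thesis
      using 3 uv by (auto simp: ab pos_def prim_gt_iff algebra_simps)
  qed
qed

lemma inj_on_pos: "inj_on (pos m) (ZP m)"
proof (rule inj_onI)
  fix a b assume ab: "a \<in> ZP m" "b \<in> ZP m" "pos m a = pos m b"
  then have "\<not> prim_gt b a" "\<not> prim_gt a b"
    using pos_less_iff[of a m b] pos_less_iff[of b m a] by auto
  then show "a = b"
    by (auto simp: prim_gt_iff prod_eq_iff)
qed

lemma eta_in_ZP: "e \<in> ZS m \<Longrightarrow> eta e \<in> ZP m"
  and zeta_in_ZP: "e \<in> ZS m \<Longrightarrow> zeta e \<in> ZP m"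
  by (cases e; auto simp: ZS_def ZP_def)+

lemma lo_hi_inj:
  assumes "e \<in> ZS m" "e' \<in> ZS m" "lo m e = lo m e'" "hi m e = hi m e'"
  shows "e = e'"
proof -
  have "eta e = eta e'" "zeta e = zeta e'"
    using assms inj_onD[OF inj_on_pos] eta_in_ZP zeta_in_ZP unfolding lo_def hi_def by blast+
  then show ?thesis using eta_zeta_inj assms by blast
qed

lemma lo_le_hi:
  assumes "e \<in> ZS m"
  shows "lo m e \<le> hi m e" "hi m e \<le> lo m e + int m"
  using assms by (cases e; auto simp: ZS_def lo_def hi_def pos_def algebra_simps)+

text \<open>Parity decides which of \<open>x\<close> and \<open>y\<close> belongs to which end, and
  the sum does not see this. It turns membership in \<open>Omega\<close> and \<open>ZS_pos\<close>
  into linear conditions.\<close>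

lemma lo_add_hi: "lo m (k, x, y) + hi m (k, x, y) = k * int m + int x + int y"
proof (cases "even k")
  case True
  then obtain a where "k = 2 * a" by (rule evenE)
  then show ?thesis by (simp add: lo_def hi_def pos_def algebra_simps)
next
  case False
  then obtain a where "k = 2 * a + 1" by (rule oddE)
  then show ?thesis by (simp add: lo_def hi_def pos_def algebra_simps)
qed

section \<open>The two relations on parts in coordinates\<close>

text \<open>The parity of \<open>k - l\<close> rounds the bound \<open>rho\<close> up. An even
  difference treats 1 and 2 alike, which absorbs the subtracted term. An odd difference treats 0 and
  1 alike, and \<open>rho\<close> equals 2 precisely when \<open>y' \<le> x\<close>.\<close>

lemma gg_rho_iff_prim_gt:
  assumes "e \<in> ZS m" "e' \<in> ZS m"
  shows "gg_rho e e' \<longleftrightarrow> prim_gt (eta e) (eta e') \<and> prim_gt (zeta e) (zeta e')"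
proof -
  obtain k x' y' l x y where e: "e = (k, x', y')" "e' = (l, x, y)"
    by (metis prod.exhaust)
  have xy: "x' \<le> y'" "x \<le> y"
    using assms by (auto simp: e ZS_def)
  obtain a where a: "k = 2 * a \<or> k = 2 * a + 1" by (metis evenE oddE)
  obtain b where b: "l = 2 * b \<or> l = 2 * b + 1" by (metis evenE oddE)
  show ?thesis
    using a b xy by (elim disjE) (auto simp: e of_bool_def split: if_splits)
qed

lemma gg_rho_iff:
  assumes "e \<in> ZS m" "e' \<in> ZS m"
  shows "gg_rho e e' \<longleftrightarrow> lo m e' < lo m e \<and> hi m e' < hi m e"
  unfolding gg_rho_iff_prim_gt[OF assms] lo_def hi_def
  using assms by (auto simp: pos_less_iff eta_in_ZP zeta_in_ZP)

lemma sec_ge_if_hi_less: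
  assumes "e \<in> ZS m" "e' \<in> ZS m" "hi m e' < hi m e"
  shows "sec_ge e e'"
  using assms by (auto simp: sec_ge_def hi_def pos_less_iff eta_in_ZP)

lemma hi_le_if_sec_ge:
  assumes "e \<in> ZS m" "e' \<in> ZS m" "sec_ge e e'"
  shows "hi m e' \<le> hi m e"
proof -
  have "\<not> hi m e < hi m e'"
    using assms by (auto simp: sec_ge_def hi_def pos_less_iff eta_in_ZP prim_gt_iff)
  then show ?thesis by simp
qed

section \<open>\<open>Omega\<close> and \<open>ZS_pos\<close> through the sum of the end
  points\<close>

text \<open>Since \<open>x + y\<close> lies between 2 and \<open>2 * m\<close>, only the sizes 0 and
  -1 remain to be examined in the characterisations below.\<close>

lemma sec_sum_bounds:
  assumes "m \<ge> 1" "(k, x, y) \<in> ZS m"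
  shows "k \<ge> 1 \<Longrightarrow> lo m (k, x, y) + hi m (k, x, y) \<ge> int m + 2"
    and "k \<le> -2 \<Longrightarrow> lo m (k, x, y) + hi m (k, x, y) \<le> 0"
proof -
  have xy: "1 \<le> x" "x \<le> y" "y \<le> m"
    using assms by (auto simp: ZS_def)
  show "lo m (k, x, y) + hi m (k, x, y) \<ge> int m + 2" if "k \<ge> 1"
    using mult_right_mono[OF that, of "int m"] xy unfolding lo_add_hi by linarith
  show "lo m (k, x, y) + hi m (k, x, y) \<le> 0" if "k \<le> -2"
    using mult_right_mono[OF that, of "int m"] xy unfolding lo_add_hi by linarith
qed

lemma Omega_subset: "m \<ge> 1 \<Longrightarrow> Omega m \<subseteq> ZS m"
  by (auto simp: Omega_def omega_def ZS_def bar_def)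

text \<open>At size 0, \<open>x > bar m y\<close> says \<open>x + y \<ge> m + 2\<close>; at size -1
  the sum is at most \<open>m\<close>.\<close>

lemma ZS_pos_iff:
  assumes "m \<ge> 1" "e \<in> ZS m"
  shows "e \<in> ZS_pos m \<longleftrightarrow> lo m e + hi m e \<ge> int m + 2"
proof -
  obtain k x y where e: "e = (k, x, y)" by (cases e)
  have xy: "1 \<le> x" "x \<le> y" "y \<le> m"
    using assms by (auto simp: e ZS_def)
  consider "k \<ge> 1" | "k = 0" | "k = -1" | "k \<le> -2" by linarith
  then show ?thesis
  proof cases
    case 1
    then show ?thesis
      using sec_sum_bounds(1)[of m k x y] assms by (auto simp: e ZS_pos_def)
  next
    case 2
    then show ?thesis using xy unfolding e lo_add_hi by (auto simp: ZS_pos_def bar_def)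
  next
    case 3
    then show ?thesis using xy unfolding e lo_add_hi by (auto simp: ZS_pos_def)
  next
    case 4
    then show ?thesis
      using sec_sum_bounds(2)[of m k x y] assms by (auto simp: e ZS_pos_def)
  qed
qed

text \<open>At size 0 the two families in \<open>Omega\<close> are the solutions of
  \<open>x + y = m\<close> and \<open>x + y = m + 1\<close>. At size -1 the sum reaches
  \<open>m\<close> only for \<open>x = y = m\<close>, which is \<open>omega m 0\<close>.\<close>

lemma Omega_iff:
  assumes "m \<ge> 1" "e \<in> ZS m"
  shows "e \<in> Omega m \<longleftrightarrow> lo m e + hi m e = int m \<or> lo m e + hi m e = int m + 1"
proof -
  obtain k x y where e: "e = (k, x, y)" by (cases e)
  have xy: "1 \<le> x" "x \<le> y" "y \<le> m"
    using assms by (auto simp: e ZS_def)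
  consider "k \<ge> 1" | "k = 0" | "k = -1" | "k \<le> -2" by linarith
  then show ?thesis
  proof cases
    case 1
    then have "e \<notin> Omega m"
      by (auto simp: e Omega_def omega_def)
    then show ?thesis
      using sec_sum_bounds(1)[OF assms[unfolded e] 1] assms(1) e by simp
  next
    case 2
    have "e \<in> Omega m \<longleftrightarrow>
        (\<exists>u. u \<le> m div 2 \<and> u \<noteq> 0 \<and> x = u \<and> y = bar m (u + 1)) \<or>
        (\<exists>u. 1 \<le> u \<and> u \<le> (m + 1) div 2 \<and> x = u \<and> y = bar m u)"
      unfolding e Omega_def omega_def using 2 by (auto split: if_splits)
    also have "\<dots> \<longleftrightarrow> x \<le> m div 2 \<and> y = m - x \<or> x \<le> (m + 1) div 2 \<and> y = m + 1 - x"
      using xy by (auto simp: bar_def)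
    \<comment> \<open>The upper bounds on \<open>x\<close> express \<open>x \<le> y\<close>.\<close>
    also have "\<dots> \<longleftrightarrow> x + y = m \<or> x + y = m + 1"
      using xy by linarith
    finally show ?thesis
      unfolding e lo_add_hi using 2 by (simp add: of_nat_add[symmetric] del: of_nat_add) linarith
  next
    case 3
    have "e \<in> Omega m \<longleftrightarrow> x = m \<and> y = m"
      using 3 by (auto simp: e Omega_def omega_def)
    then show ?thesis using 3 xy unfolding e lo_add_hi by auto
  next
    case 4
    then have "e \<notin> Omega m"
      by (auto simp: e Omega_def omega_def)
    then show ?thesis
      using sec_sum_bounds(2)[OF assms[unfolded e] 4] assms(1) e by simp
  qed
qed

lemma Omega_Un_ZS_pos_iff:
  assumes "m \<ge> 1" "e \<in> ZS m"
  shows "e \<in> Omega m \<union> ZS_pos m \<longleftrightarrow> lo m e + hi m e \<ge> int m"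
  using Omega_iff[OF assms] ZS_pos_iff[OF assms] by auto

section \<open>Successors and path steps in coordinates\<close>

lemma psucc_in_ZP: "m \<ge> 1 \<Longrightarrow> a \<in> ZP m \<Longrightarrow> psucc m a \<in> ZP m"
  using bij_betw_apply[OF bij_betw_psucc] .

lemma pos_psucc: "a \<in> ZP m \<Longrightarrow> pos m (psucc m a) = pos m a + 1"
  by (cases a) (auto simp: ZP_def pos_def algebra_simps)

lemma pos_psucc_funpow:
  assumes "m \<ge> 1" "a \<in> ZP m"
  shows "(psucc m ^^ u) a \<in> ZP m \<and> pos m ((psucc m ^^ u) a) = pos m a + int u"
  by (induction u) (use assms in \<open>auto simp: psucc_in_ZP pos_psucc\<close>)

lemma ppred_in_ZP:
  assumes "m \<ge> 1" "a \<in> ZP m"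
  shows "ppred m a \<in> ZP m"
  using assms bij_betw_imp_surj_on[OF bij_betw_psucc] unfolding ppred_def
  by (metis inv_into_into)

lemma pos_ppred:
  assumes "m \<ge> 1" "a \<in> ZP m"
  shows "pos m (ppred m a) = pos m a - 1"
proof -
  have "psucc m (ppred m a) = a"
    using assms bij_betw_imp_surj_on[OF bij_betw_psucc] unfolding ppred_def
    by (metis f_inv_into_f)
  then show ?thesis
    using pos_psucc[OF ppred_in_ZP[OF assms]] by simp
qed

lemma sec_of_lo_hi:
  assumes "a \<in> ZP m" "b \<in> ZP m" "pos m b \<le> pos m a" "pos m a \<le> pos m b + int m"
  shows "sec_of m a b \<in> ZS m" "lo m (sec_of m a b) = pos m b" "hi m (sec_of m a b) = pos m a"
proof -
  \<comment> \<open>Raising the size by one moves a point by \<open>m\<close>, so the last condition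
    of \<open>sec_of_unique\<close> bounds the length by \<open>m\<close>.\<close>
  have b': "(fst b + 1, snd b) \<in> ZP m" "pos m (fst b + 1, snd b) = pos m b + int m"
    using assms(2) by (auto simp: ZP_def pos_def algebra_simps)
  have ge: "prim_ge c d" if "c \<in> ZP m" "d \<in> ZP m" "pos m d \<le> pos m c" for c d
    using pos_less_iff[of c m d] that by (auto simp: prim_ge_iff prim_gt_iff)
  have "\<exists>!e. e \<in> ZS m \<and> eta e = a \<and> zeta e = b"
    using assms b' by (intro sec_of_unique ge) auto
  then have "sec_of m a b \<in> ZS m \<and> eta (sec_of m a b) = a \<and> zeta (sec_of m a b) = b"
    unfolding sec_of_def by (rule theI')
  then show "sec_of m a b \<in> ZS m" "lo m (sec_of m a b) = pos m b" "hi m (sec_of m a b) = pos m a"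
    by (auto simp: lo_def hi_def)
qed

lemma pos_surj:
  assumes "m \<ge> 1"
  shows "\<exists>a\<in>ZP m. pos m a = z"
proof (intro bexI)
  have m: "int m > 0" using assms by simp
  have "int (nat ((z - 1) mod int m)) = (z - 1) mod int m"
    using m by simp
  \<comment> \<open>Remainders run from 0 to \<open>m - 1\<close> but colour indices from 1 to
    \<open>m\<close>, hence the shift by one.\<close>
  then show "pos m ((z - 1) div int m, nat ((z - 1) mod int m) + 1) = z"
    using div_mult_mod_eq[of "z - 1" "int m"] by (simp add: pos_def)
  have "nat ((z - 1) mod int m) < m"
    using pos_mod_bound[OF m, of "z - 1"] m by linarith
  then show "((z - 1) div int m, nat ((z - 1) mod int m) + 1) \<in> ZP m"
    by (auto simp: ZP_def)
qed

lemma interval_exists: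
  assumes "m \<ge> 1" "z \<le> h" "h \<le> z + int m"
  shows "\<exists>e\<in>ZS m. lo m e = z \<and> hi m e = h"
  using pos_surj[OF assms(1), of z] pos_surj[OF assms(1), of h] sec_of_lo_hi assms(2,3) by metis

text \<open>A successor moves a point by one, so the exponent in \<open>extendable\<close> is the
  length of the interval.\<close>

lemma extendable_iff:
  assumes "m \<ge> 1" "e \<in> ZS m"
  shows "extendable m e \<longleftrightarrow> hi m e < lo m e + int m"
proof
  assume "extendable m e"
  then show "hi m e < lo m e + int m"
    using pos_psucc_funpow[OF assms(1) zeta_in_ZP[OF assms(2)]]
    by (auto simp: extendable_def lo_def hi_def)
next
  assume lt: "hi m e < lo m e + int m"
  define u where "u = nat (hi m e - lo m e)"
  have u: "int u = hi m e - lo m e"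
    using lo_le_hi[OF assms(2)] by (simp add: u_def)
  have "eta e = (psucc m ^^ u) (zeta e)"
    using pos_psucc_funpow[OF assms(1) zeta_in_ZP[OF assms(2)], of u] u
    by (intro inj_onD[OF inj_on_pos[of m]]) (auto simp: lo_def hi_def eta_in_ZP[OF assms(2)])
  then show "extendable m e"
    using assms lt u unfolding extendable_def by (intro conjI exI[of _ u]) auto
qed

text \<open>The strict bound leaves room for one more unit of length, so the description behind
  \<open>dstep\<close> still denotes an element.\<close>

lemma dstep_lo_hi:
  assumes "m \<ge> 1" "e \<in> ZS m" "hi m e < lo m e + int m"
  shows "dstep m e \<in> ZS m" "lo m (dstep m e) = lo m e - 1" "hi m (dstep m e) = hi m e"
  using sec_of_lo_hi[of "eta e" m "ppred m (zeta e)"] assms lo_le_hi[OF assms(2)]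
    eta_in_ZP[OF assms(2)] zeta_in_ZP[OF assms(2)]
  by (auto simp: dstep_def ppred_in_ZP pos_ppred lo_def hi_def)

lemma fstep_lo_hi:
  assumes "m \<ge> 1" "e \<in> ZS m" "hi m e < lo m e + int m"
  shows "fstep m e \<in> ZS m" "lo m (fstep m e) = lo m e" "hi m (fstep m e) = hi m e + 1"
  using sec_of_lo_hi[of "psucc m (eta e)" m "zeta e"] assms lo_le_hi[OF assms(2)]
    eta_in_ZP[OF assms(2)] zeta_in_ZP[OF assms(2)]
  by (auto simp: fstep_def psucc_in_ZP pos_psucc lo_def hi_def)

lemma step_iff:
  assumes "m \<ge> 1" "e \<in> ZS m" "hi m e < lo m e + int m" "e' \<in> ZS m"
  shows "e' \<in> {dstep m e, fstep m e} \<longleftrightarrow>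
    lo m e' = lo m e - 1 \<and> hi m e' = hi m e \<or> lo m e' = lo m e \<and> hi m e' = hi m e + 1"
  using dstep_lo_hi[OF assms(1-3)] fstep_lo_hi[OF assms(1-3)]
    lo_hi_inj[OF assms(4)] by (metis insert_iff singletonD)

section \<open>Nested intervals and paths\<close>

text \<open>Reflexive, so that a repeated part also counts as a nested pair.\<close>

definition nested :: "nat \<Rightarrow> sec \<Rightarrow> sec \<Rightarrow> bool" where
  "nested m e e' \<longleftrightarrow> lo m e' \<le> lo m e \<and> hi m e \<le> hi m e'"

text \<open>Each step moves one end outward by one. The length therefore grows strictly, which
  separates the entries.\<close>

lemma path_in_nested:
  assumes "m \<ge> 1" "path_in m X es" "i < j" "j \<le> m"
  shows "nested m (es ! i) (es ! j) \<and> es ! i \<noteq> es ! j"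
proof -
  have step: "nested m (es ! k) (es ! Suc k) \<and>
      hi m (es ! Suc k) - lo m (es ! Suc k) = hi m (es ! k) - lo m (es ! k) + 1" if "k < m" for k
  proof -
    have in_ZS: "es ! k \<in> ZS m" "es ! Suc k \<in> ZS m"
      using assms(2) that nth_mem[of k es] nth_mem[of "Suc k" es] by (auto simp: path_in_def)
    moreover have "extendable m (es ! k)" "es ! Suc k \<in> {dstep m (es ! k), fstep m (es ! k)}"
      using assms(2) that by (auto simp: path_in_def)
    ultimately show ?thesis
      using step_iff[OF assms(1) in_ZS(1) _ in_ZS(2)] extendable_iff[OF assms(1)]
      by (auto simp: nested_def)
  qed
  have "nested m (es ! i) (es ! (i + Suc n)) \<and>
      hi m (es ! (i + Suc n)) - lo m (es ! (i + Suc n)) > hi m (es ! i) - lo m (es ! i)"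
    if "i + Suc n \<le> m" for n
    using that
  proof (induction n)
    case 0
    then show ?case using step[of i] by simp
  next
    case (Suc n)
    then show ?case using step[of "i + Suc n"] by (auto simp: nested_def)
  qed
  from this[of "j - Suc i"] show ?thesis
    using assms(3,4) by auto
qed

lemma nested_path_exists:
  assumes m: "m \<ge> 1" and X: "X = Omega m \<union> ZS_pos m"
    and e: "e \<in> ZS m" "e \<in> X" and e': "e' \<in> ZS m" "e' \<in> X" and nested: "nested m e e'"
  shows "\<exists>es. path_in m X es \<and> e \<in> set es \<and> e' \<in> set es"
proof -
  let ?z = "lo m e" and ?h = "hi m e" and ?z' = "lo m e'" and ?h' = "hi m e'"
  have bounds: "?z \<le> ?h" "?z' \<le> ?z" "?h \<le> ?h'" "?h' \<le> ?z' + int m"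
    using nested lo_le_hi e e' by (auto simp: nested_def)
  have sums: "?z + ?h \<ge> int m" "?z' + ?h' \<ge> int m"
    using Omega_Un_ZS_pos_iff[OF m] e e' by (auto simp: X)
  \<comment> \<open>From the point \<open>?h\<close> grow left to \<open>e\<close>, then right, then left to \<open>e'\<close>, then right: the sum of the
    end points never drops below its values at \<open>e\<close> and \<open>e'\<close>.\<close>
  define l where "l j = (if int j \<le> ?h - ?z then ?h - int j else if int j \<le> ?h' - ?z then ?z
    else if int j \<le> ?h' - ?z' then ?h' - int j else ?z')" for j :: nat
  have "\<forall>j. \<exists>a. j \<le> m \<longrightarrow> a \<in> ZS m \<and> lo m a = l j \<and> hi m a = l j + int j"
    using interval_exists[OF m] by (metis le_add_same_cancel1 add_le_cancel_left of_nat_0_le_iff of_nat_le_iff)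
  then obtain g where g: "\<And>j. j \<le> m \<Longrightarrow> g j \<in> ZS m \<and> lo m (g j) = l j \<and> hi m (g j) = l j + int j"
    by metis
  define es where "es = map g [0..<m + 1]"
  have length_es: "length es = m + 1"
    by (simp add: es_def)
  have nth: "es ! j = g j" if "j \<le> m" for j
    using that by (simp add: es_def del: upt_Suc)
  have "g j \<in> X" if "j \<le> m" for j
  proof -
    have "l j + (l j + int j) \<ge> int m"
      using bounds sums by (auto simp: l_def)
    then show ?thesis
      using g[OF that] Omega_Un_ZS_pos_iff[OF m, of "g j"] by (auto simp: X)
  qed
  then have "set es \<subseteq> ZS m \<inter> X"
    using g by (auto simp: es_def)
  moreover have "extendable m (es ! j) \<and> es ! (j + 1) \<in> {dstep m (es ! j), fstep m (es ! j)}"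
    if "j < m" for j
  proof -
    have gj: "g j \<in> ZS m" "lo m (g j) = l j" "hi m (g j) = l j + int j"
      and gS: "g (j + 1) \<in> ZS m" "lo m (g (j + 1)) = l (j + 1)"
        "hi m (g (j + 1)) = l (j + 1) + int (j + 1)"
      using g[of j] g[of "j + 1"] that by auto
    \<comment> \<open>The right end is \<open>l j + int j\<close>, so a constant \<open>l\<close>
      means \<open>fstep\<close> and a drop by one means \<open>dstep\<close>.\<close>
    have "l (j + 1) = l j - 1 \<or> l (j + 1) = l j"
      using bounds by (auto simp: l_def)
    then have "g (j + 1) \<in> {dstep m (g j), fstep m (g j)}"
      using step_iff[OF m gj(1) _ gS(1)] gj gS that by auto
    then show ?thesis
      using extendable_iff[OF m gj(1)] gj that by (simp add: nth)
  qed
  ultimately have "path_in m X es"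
    by (simp add: path_in_def es_def)
  moreover have "e \<in> set es"
  proof -
    \<comment> \<open>An interval sits in the chain at the index equal to its length.\<close>
    let ?j = "nat (?h - ?z)"
    have j: "?j \<le> m" "int ?j = ?h - ?z" using bounds by auto
    have "l ?j = ?z" using j by (simp add: l_def)
    then have "g ?j = e"
      using g[OF j(1)] j e by (intro lo_hi_inj[of _ m]) auto
    then show ?thesis
      using j(1) nth_mem[of ?j es] by (simp add: nth length_es)
  qed
  moreover have "e' \<in> set es"
  proof -
    let ?j = "nat (?h' - ?z')"
    have j: "?j \<le> m" "int ?j = ?h' - ?z'" using bounds by auto
    have "l ?j = ?z'" using j bounds by (auto simp: l_def)
    then have "g ?j = e'"
      using g[OF j(1)] j e' by (intro lo_hi_inj[of _ m]) auto
    then show ?thesis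
      using j(1) nth_mem[of ?j es] by (simp add: nth length_es)
  qed
  ultimately show ?thesis by blast
qed

section \<open>The path condition as absence of nesting\<close>

text \<open>The coordinate sums keep \<open>Omega\<close> and \<open>ZS_pos\<close> disjoint, so
  prescribing the frequencies on \<open>Omega\<close> amounts to adjoining one copy of
  \<open>w\<close>.\<close>

lemma freq_eq_count:
  assumes "m \<ge> 1" "w \<in> Omega m" "set_mset M \<subseteq> ZS_pos m"
  shows "freq m w M e = count (add_mset w M) e"
proof -
  have "e \<notin># M" if "e \<in> Omega m"
  proof -
    have "e \<in> ZS m" using that Omega_subset[OF assms(1)] by blast
    then have "e \<notin> ZS_pos m"
      using that Omega_iff[OF assms(1)] ZS_pos_iff[OF assms(1)] by auto
    then show ?thesis using assms(3) by blast
  qed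
  then show ?thesis
    using assms(2) by (auto simp: freq_def not_in_iff)
qed

lemma sum_list_nat_le_1:
  fixes f :: "'a \<Rightarrow> nat"
  assumes "\<And>x. x \<in> set xs \<Longrightarrow> f x \<le> 1"
    and "sorted_wrt (\<lambda>x y. f x = 0 \<or> f y = 0) xs"
  shows "(\<Sum>x\<leftarrow>xs. f x) \<le> 1"
  using assms
proof (induction xs)
  case (Cons x xs)
  show ?case
  proof (cases "f x = 0")
    case False
    then have "\<forall>y\<in>set xs. f y = 0" using Cons.prems(2) by simp
    then have "sum_list (map f xs) = 0"
      by (induction xs) auto
    moreover have "f x \<le> 1"
      using Cons.prems(1) by simp
    ultimately show ?thesis by (simp only: list.map sum_list.Cons)
  qed (use Cons in auto)
qed simp

lemma path_condition_if_sorted: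
  assumes "m \<ge> 1" "w \<in> Omega m" "set \<pi> \<subseteq> ZS_pos m"
    and sorted: "sorted_wrt (\<lambda>a b. \<not> nested m a b \<and> \<not> nested m b a) (\<pi> @ [w])"
  shows "path_condition m w (mset \<pi>)"
  unfolding path_condition_def
proof (intro allI impI)
  fix es assume es: "path_in m (Omega m \<union> ZS_pos m) es"
  have freq: "freq m w (mset \<pi>) e = count (mset (\<pi> @ [w])) e" for e
    using freq_eq_count[OF assms(1,2), of "mset \<pi>" e] assms(3) by simp
  have not_nested: "\<not> nested m a b"
    if "a \<in> set (\<pi> @ [w])" "b \<in> set (\<pi> @ [w])" "a \<noteq> b" for a b
    using that sorted unfolding sorted_wrt_iff_nth_less in_set_conv_nth by (metis nat_neq_iff)
  \<comment> \<open>Equal entries would be nested, so every multiplicity is at most one.\<close>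
  have "sorted_wrt (\<noteq>) (\<pi> @ [w])"
    by (rule sorted_wrt_mono_rel[OF _ sorted]) (auto simp: nested_def)
  then have "distinct (\<pi> @ [w])"
    by (simp add: distinct_conv_nth sorted_wrt_iff_nth_less) (metis nat_neq_iff)
  then have le1: "count (mset (\<pi> @ [w])) e \<le> 1" for e
    by (simp only: distinct_count_atmost_1) simp
  have "sorted_wrt (\<lambda>a b. count (mset (\<pi> @ [w])) a = 0 \<or> count (mset (\<pi> @ [w])) b = 0) es"
    unfolding sorted_wrt_iff_nth_less
  proof (intro allI impI)
    fix i j assume ij: "i < j" "j < length es"
    then have "nested m (es ! i) (es ! j) \<and> es ! i \<noteq> es ! j"
      using path_in_nested[OF assms(1) es] es by (simp add: path_in_def)
    then show "count (mset (\<pi> @ [w])) (es ! i) = 0 \<or> count (mset (\<pi> @ [w])) (es ! j) = 0"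
      using not_nested by (metis count_mset_0_iff)
  qed
  then show "(\<Sum>e\<leftarrow>es. freq m w (mset \<pi>) e) \<le> 1"
    unfolding freq by (rule sum_list_nat_le_1[OF le1])
qed

text \<open>A path through both \<open>a\<close> and \<open>b\<close> would carry total frequency at
  least 2. Stating the pair as a multiset includes \<open>a = b\<close> occurring twice.\<close>

lemma not_nested_if_path_condition:
  assumes "m \<ge> 1" "w \<in> Omega m" "set \<pi> \<subseteq> ZS_pos m" "path_condition m w (mset \<pi>)"
    and ab: "{#a, b#} \<subseteq># mset (\<pi> @ [w])"
  shows "\<not> nested m a b"
proof
  assume nested: "nested m a b"
  have sub: "set (\<pi> @ [w]) \<subseteq> ZS m \<inter> (Omega m \<union> ZS_pos m)"
    using assms(2,3) ZS_pos_subset Omega_subset[OF assms(1)] by auto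
  have "set_mset {#a, b#} \<subseteq> set_mset (mset (\<pi> @ [w]))"
    using ab by (rule set_mset_mono)
  then have "a \<in> ZS m \<inter> (Omega m \<union> ZS_pos m)" "b \<in> ZS m \<inter> (Omega m \<union> ZS_pos m)"
    using sub by auto
  then obtain es where es: "path_in m (Omega m \<union> ZS_pos m) es" "a \<in> set es" "b \<in> set es"
    using nested_path_exists[OF assms(1) refl _ _ _ _ nested] by auto
  define f where "f = count (mset (\<pi> @ [w]))"
  have "2 = (\<Sum>e\<in>{a, b}. count {#a, b#} e)"
    by (cases "a = b") auto
  also have "\<dots> \<le> (\<Sum>e\<in>{a, b}. f e)"
    using ab unfolding f_def by (intro sum_mono mset_subset_eq_count)
  also have "\<dots> \<le> (\<Sum>e\<in>set es. f e)"
    using es by (intro sum_mono2) auto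
  also have "\<dots> \<le> (\<Sum>e\<leftarrow>es. f e)"
    unfolding sum_list_map_eq_sum_count
  proof (rule sum_mono)
    fix e assume "e \<in> set es"
    then have "count_list es e \<ge> 1"
      using count_list_0_iff[of es e] by linarith
    then show "f e \<le> count_list es e * f e" by simp
  qed
  finally have "(\<Sum>e\<leftarrow>es. f e) \<ge> 2" .
  moreover have "freq m w (mset \<pi>) = f"
    using freq_eq_count[OF assms(1,2), of "mset \<pi>"] assms(3) by (simp add: f_def fun_eq_iff)
  ultimately have "\<not> (\<Sum>e\<leftarrow>es. freq m w (mset \<pi>) e) \<le> 1" by simp
  then show False
    using assms(4) es(1) unfolding path_condition_def by blast
qed

section \<open>Comparison of the two sets of partitions\<close>

lemma P_rho_eq:
  assumes "m \<ge> 1" "w \<in> Omega m"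
  shows "P_rho m w = (\<lambda>\<pi>. \<pi> @ [w]) ` P_S m w"
proof -
  let ?gt = "\<lambda>a b. lo m b < lo m a \<and> hi m b < hi m a"
  have w: "w \<in> ZS m"
    using assms Omega_subset by blast
  have w_sum: "lo m w + hi m w = int m \<or> lo m w + hi m w = int m + 1"
    using Omega_iff[OF assms(1) w] assms(2) by simp
  have gg: "successively gg_rho (\<pi> @ [w]) \<longleftrightarrow> sorted_wrt ?gt (\<pi> @ [w])" if "set \<pi> \<subseteq> ZS m" for \<pi>
  proof -
    have "successively gg_rho (\<pi> @ [w]) \<longleftrightarrow> successively ?gt (\<pi> @ [w])"
      using that w by (intro successively_cong gg_rho_iff refl) auto
    \<comment> \<open>In coordinates the relation is visibly transitive, so comparing neighbours
      compares all pairs.\<close>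
    also have "\<dots> \<longleftrightarrow> sorted_wrt ?gt (\<pi> @ [w])"
      by (intro successively_iff_sorted_wrt_strong) auto
    finally show ?thesis .
  qed
  have "set \<pi> \<subseteq> ZS m \<and> sorted_wrt ?gt (\<pi> @ [w]) \<longleftrightarrow> \<pi> \<in> P_S m w" for \<pi>
  proof
    assume \<pi>: "set \<pi> \<subseteq> ZS m \<and> sorted_wrt ?gt (\<pi> @ [w])"
    have "a \<in> ZS_pos m" if a: "a \<in> set \<pi>" for a
    proof -
      \<comment> \<open>Both ends exceed those of \<open>w\<close> by at least one, which lifts the
        sum to at least \<open>m + 2\<close>.\<close>
      have "?gt a w" using a \<pi> by (simp add: sorted_wrt_append)
      then show ?thesis using ZS_pos_iff[OF assms(1), of a] a \<pi> w_sum by auto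
    qed
    then have pos: "set \<pi> \<subseteq> ZS_pos m" by blast
    have "sorted_wrt ?gt \<pi>"
      using \<pi> by (simp add: sorted_wrt_append)
    then have "sorted_wrt sec_ge \<pi>"
      by (rule sorted_wrt_mono_rel[rotated]) (use \<pi> in \<open>auto intro: sec_ge_if_hi_less\<close>)
    moreover have "sorted_wrt (\<lambda>a b. \<not> nested m a b \<and> \<not> nested m b a) (\<pi> @ [w])"
      by (rule sorted_wrt_mono_rel[OF _ conjunct2[OF \<pi>]]) (auto simp: nested_def)
    then have "path_condition m w (mset \<pi>)"
      by (rule path_condition_if_sorted[OF assms pos])
    ultimately show "\<pi> \<in> P_S m w"
      using pos by (simp add: P_S_def)
  next
    assume "\<pi> \<in> P_S m w"
    then have pos: "set \<pi> \<subseteq> ZS_pos m" and ge: "sorted_wrt sec_ge \<pi>"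
      and path: "path_condition m w (mset \<pi>)"
      by (auto simp: P_S_def)
    note not_nested = not_nested_if_path_condition[OF assms pos path]
    have ZS: "set \<pi> \<subseteq> ZS m"
      using pos ZS_pos_subset by blast
    have "?gt (\<pi> ! i) (\<pi> ! j)" if ij: "i < j" "j < length \<pi>" for i j
    proof -
      let ?a = "\<pi> ! i" and ?b = "\<pi> ! j"
      have in_ZS: "?a \<in> ZS m" "?b \<in> ZS m"
        using ij ZS nth_mem[of i \<pi>] nth_mem[of j \<pi>] by auto
      \<comment> \<open>Cutting at \<open>j\<close> separates the two positions, so the pair is a
        submultiset even if the parts coincide.\<close>
      have "\<pi> = take j \<pi> @ ?b # drop (Suc j) \<pi>"
        using ij by (simp add: id_take_nth_drop)
      then have "mset \<pi> = mset (take j \<pi>) + mset (?b # drop (Suc j) \<pi>)"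
        by (metis mset_append)
      moreover have "?a \<in># mset (take j \<pi>)"
        using ij by (auto simp: in_set_conv_nth)
      ultimately have "{#?a, ?b#} \<subseteq># mset (\<pi> @ [w])"
        by (auto dest!: multi_member_split)
      then have nn: "\<not> nested m ?a ?b" "\<not> nested m ?b ?a"
        using not_nested by (auto simp: add_mset_commute)
      \<comment> \<open>Intervals that are not nested have both ends ordered the same way;
        \<open>sec_ge\<close> settles the direction.\<close>
      moreover have "hi m ?b \<le> hi m ?a"
        using ge ij hi_le_if_sec_ge[OF in_ZS] by (simp add: sorted_wrt_iff_nth_less)
      ultimately show ?thesis
        by (auto simp: nested_def)
    qed
    then have "sorted_wrt ?gt \<pi>"
      unfolding sorted_wrt_iff_nth_less by blast
    moreover have "?gt a w" if a: "a \<in> set \<pi>" for a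
    proof -
      have "{#a, w#} \<subseteq># mset (\<pi> @ [w])"
        using a by simp
      then have "\<not> nested m a w" "\<not> nested m w a"
        using not_nested by (auto simp: add_mset_commute)
      \<comment> \<open>Against \<open>w\<close> the direction comes from the larger sum.\<close>
      moreover have "lo m a + hi m a \<ge> int m + 2"
        using ZS_pos_iff[OF assms(1)] a pos ZS by blast
      ultimately show ?thesis
        using w_sum by (auto simp: nested_def)
    qed
    ultimately show "set \<pi> \<subseteq> ZS m \<and> sorted_wrt ?gt (\<pi> @ [w])"
      using ZS by (simp add: sorted_wrt_append)
  qed
  then have "set \<pi> \<subseteq> ZS m \<and> successively gg_rho (\<pi> @ [w]) \<longleftrightarrow> \<pi> \<in> P_S m w" for \<pi>
    using gg by blast
  then show ?thesis
    unfolding P_rho_def by auto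
qed

theorem theorem5p8:
  fixes m :: nat and \<omega> :: sec
  assumes "m \<ge> 1" and "\<omega> \<in> Omega m"
  shows "\<exists>\<Lambda>. bij_betw \<Lambda> (P_rho m \<omega>) (P_S m \<omega>) \<and>
    (\<forall>\<pi>\<in>P_rho m \<omega>. part_size (\<Lambda> \<pi>) = part_size (butlast \<pi>) \<and>
                   colour_seq (\<Lambda> \<pi>) = colour_seq (butlast \<pi>))"
proof (intro exI conjI ballI)
  \<comment> \<open>With \<open>butlast\<close> itself as the bijection, both preservation claims
    become identities.\<close>
  show "bij_betw butlast (P_rho m \<omega>) (P_S m \<omega>)"
    unfolding P_rho_eq[OF assms] by (rule bij_betw_byWitness[where f' = "\<lambda>\<pi>. \<pi> @ [\<omega>]"]) auto
qed simp_all

end
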